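(* Let $J,K$ be fixed positive integers and let $p\in(0,1]$ be given. Let $(\boldsymbol\Lambda^*,\boldsymbol\Phi^*,\boldsymbol\Omega^* )$ be the true parameters, where $\boldsymbol\Lambda^*=(\lambda^*_{jk})\in\mathbb R^{J\times K}$, $\boldsymbol\Phi^*$ is a $K\times K$ symmetric positive definite matrix with unit diagonal, and $\boldsymbol\Omega^*$ is a $J\times J$ diagonal covariance matrix. For each sample size $N$, let $(\hat{\mathbf A}_N,\mathbf I,\hat{\boldsymbol\Omega}_N)$ be an initial (random) estimator, with $\hat{\mathbf A}_N\in\mathbb R^{J\times K}$ and $\hat{\boldsymbol\Omega}_N$ a $J\times J$ diagonal matrix. Suppose that: (C1) $\hat{\mathbf A}_N\hat{\mathbf A}_N'\to\boldsymbol\Lambda^*\boldsymbol\Phi^*\boldsymbol\Lambda^{*\prime}$ and $\hat{\boldsymbol\Omega}_N\to\boldsymbol\Omega^*$ in probability as $N\to\infty$; (C2) $\operatorname{rank}(\boldsymbol\Lambda^*\boldsymbol\Phi^*\boldsymbol\Lambda^{*\prime})=K$; (C3) $(\boldsymbol\Lambda^*,\boldsymbol\Phi^* )$ minimises $Q_p(\boldsymbol\Lambda)$ over all admissible pairs $(\boldsymbol\Lambda,\boldsymbol\Phi)$ with $\boldsymbol\Lambda\boldsymbol\Phi\boldsymbol\Lambda'=\boldsymbol\Lambda^*\boldsymbol\Phi^*\boldsymbol\Lambda^{*\prime}$, and for any other minimiser $(\boldsymbol\Lambda^\dagger,\boldsymbol\Phi^\dagger)$ of this problem there exist $\mathbf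 D\in\mathcal D_1$ and $\tilde{\mathbf D}\in\mathcal D_2$ such that $\boldsymbol\Lambda^\dagger\mathbf D\tilde{\mathbf D}=\boldsymbol\Lambda^*$ and $\tilde{\mathbf D}^{-1}\mathbf D^{-1}\boldsymbol\Phi^\dagger(\mathbf D^{-1})'(\tilde{\mathbf D}^{-1})'=\boldsymbol\Phi^*$; (C4) the threshold $c$ lies in the interval $(0,c_0)$, where $c_0=\min\{|\lambda^*_{jk}|:\lambda^*_{jk}\neq0\}$. Let $$(\hat{\boldsymbol\Lambda}_{N,p},\hat{\boldsymbol\Phi}_{N,p})\in\arg\min_{\boldsymbol\Lambda,\boldsymbol\Phi}Q_p(\boldsymbol\Lambda)\quad\text{over admissible pairs } (\boldsymbol\Lambda,\boldsymbol\Phi)\text{ such that } \boldsymbol\Lambda\boldsymbol\Phi\boldsymbol\Lambda'=\hat{\mathbf A}_N\hat{\mathbf A}_N',$$ write $\hat{\boldsymbol\Lambda}_{N,p}=(\hat\lambda^{(N,p)}_{jk})_{J\times K}$, and define $$\hat{\boldsymbol\Gamma}_{N,p}=\Big(\operatorname{sgn}(\hat\lambda^{(N,p)}_{jk})\,1_{\{|\hat\lambda^{(N,p)}_{jk}|>c\}}\Big)_{J\times K},\qquad \boldsymbol\Gamma^*=\big(\operatorname{sgn}(\lambda^*_{jk})\big)_{J\times K}.$$ Then there exist (random) $\mathbf D_N\in\mathcal D_1$ and $\tilde{\mathbf D}_N\in\mathcal D_2$ such that $P(\hat{\boldsymbol\Gamma}_{N,p}\mathbf D_N\tilde{\mathbf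 D}_N=\boldsymbol\Gamma^* )\to1$ as $N\to\infty$.
   Context: A prime denotes matrix transpose. $\operatorname{sgn}(x)=1,0,-1$ according to $x>0$, $x=0$, $x<0$. For $\boldsymbol\Lambda=(\lambda_{jk})\in\mathbb R^{J\times K}$, $Q_p(\boldsymbol\Lambda)=\sum_{j=1}^J\sum_{k=1}^K|\lambda_{jk}|^p$. A pair $(\boldsymbol\Lambda,\boldsymbol\Phi)$ is called admissible if $\boldsymbol\Lambda\in\mathbb R^{J\times K}$ and $\boldsymbol\Phi\in\mathbb R^{K\times K}$ is symmetric positive definite with $\phi_{kk}=1$ for $k=1,\dots,K$. $\mathcal D_1$ is the set of all $K\times K$ permutation matrices; $\mathcal D_2$ is the set of all $K\times K$ sign flip matrices, i.e. diagonal matrices with diagonal entries in $\{-1,1\}$. Background: the model is the linear factor model with $J$ manifest variables and $K$ (known) factors, in which the manifest vector has covariance $\boldsymbol\Lambda\boldsymbol\Phi\boldsymbol\Lambda'+\boldsymbol\Omega$; the initial estimator is computed from a sample of size $N$ with the factor covariance constrained to be $\mathbf I$. The threshold $c$ is a pre-specified constant not depending on $N$. *)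

theory Defs
  imports "HOL-Probability.Probability"
begin

definition Qp :: "real \<Rightarrow> real^'k^'j \<Rightarrow> real" where
  "Qp p L = (\<Sum>j\<in>UNIV. \<Sum>k\<in>UNIV. \<bar>L $ j $ k\<bar> powr p)"

definition symmetric_matrix :: "real^'n^'n \<Rightarrow> bool" where
  "symmetric_matrix A \<longleftrightarrow> transpose A = A"

definition positive_definite :: "real^'n^'n \<Rightarrow> bool" where
  "positive_definite A \<longleftrightarrow> (\<forall>x. x \<noteq> 0 \<longrightarrow> x \<bullet> (A *v x) > 0)"

definition diagonal_matrix :: "real^'n^'n \<Rightarrow> bool" where
  "diagonal_matrix A \<longleftrightarrow> (\<forall>i j. i \<noteq> j \<longrightarrow> A $ i $ j = 0)"

(* The type of L leaves the loading matrix unconstrained; only its shape matters. *)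
definition admissible :: "real^'k^'j \<Rightarrow> real^'k^'k \<Rightarrow> bool" where
  "admissible L F \<longleftrightarrow>
     symmetric_matrix F \<and> positive_definite F \<and> (\<forall>k. F $ k $ k = 1)"

definition is_Qp_minimiser ::
    "real \<Rightarrow> real^'j^'j \<Rightarrow> real^'k^'j \<Rightarrow> real^'k^'k \<Rightarrow> bool" where
  "is_Qp_minimiser p S L F \<longleftrightarrow>
     is_arg_min (\<lambda>(L, F). Qp p L)
       (\<lambda>(L, F). admissible L F \<and> L ** F ** transpose L = S) (L, F)"

definition permutation_matrices :: "(real^'k^'k) set" where
  "permutation_matrices =
     {(\<chi> i j. if i = \<pi> j then 1 else 0) | \<pi>. \<pi> permutes UNIV}"

definition sign_flip_matrices :: "(real^'k^'k) set" where
  "sign_flip_matrices = {D. diagonal_matrix D \<and> (\<forall>k. D $ k $ k \<in> {-1, 1})}"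

definition sgn_matrix :: "real^'k^'j \<Rightarrow> real^'k^'j" where
  "sgn_matrix L = (\<chi> j k. sgn (L $ j $ k))"

definition threshold_sgn_matrix :: "real \<Rightarrow> real^'k^'j \<Rightarrow> real^'k^'j" where
  "threshold_sgn_matrix c L =
     (\<chi> j k. sgn (L $ j $ k) * of_bool (\<bar>L $ j $ k\<bar> > c))"

(* For matrices, dist is the Frobenius distance. *)
definition tendsto_in_probability ::
    "'w measure \<Rightarrow> (nat \<Rightarrow> 'w \<Rightarrow> 'b::metric_space) \<Rightarrow> 'b \<Rightarrow> bool" where
  "tendsto_in_probability M X l \<longleftrightarrow>
     (\<forall>\<epsilon>>0. (\<lambda>N. measure M {\<omega> \<in> space M. dist (X N \<omega>) l > \<epsilon>}) \<longlonglongrightarrow> 0)"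

end

theory Submission
  imports Defs
begin

text \<open>
  The randomness enters only through the size of A A' - S, where S is the true common covariance: it
  suffices that for every A with A A' close enough to S, each minimiser for A A' has the true
  sign pattern up to signed permutation. This follows by compactness. If \<open>A\<^sub>n A\<^sub>n'\<close> tends to S, pass to
  a subsequence with \<open>A\<^sub>n\<close> tending to some A. Full rank gives \<open>\<Lambda>\<^sup>* = A T\<close> with \<open>T \<Phi>\<^sup>* T' = I\<close>, so
  \<open>(A\<^sub>n T, \<Phi>\<^sup>*)\<close> is feasible for \<open>A\<^sub>n A\<^sub>n'\<close> and has objective value tending to the true minimum.
  Hence the minimisers for \<open>A\<^sub>n A\<^sub>n'\<close> stay bounded and, along a further subsequence, converge to a
  minimiser for S, which by uniqueness is a signed column permutation of \<open>\<Lambda>\<^sup>*\<close>; the threshold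
  then separates its zero from its nonzero entries.
\<close>

section \<open>Continuity of the matrix operations and of \<open>Qp\<close>\<close>

lemma tendsto_matrix_mult [tendsto_intros]:
  fixes f :: "'a \<Rightarrow> real^'n^'m" and g :: "'a \<Rightarrow> real^'l^'n"
  assumes "(f \<longlongrightarrow> A) F" "(g \<longlongrightarrow> B) F"
  shows "((\<lambda>x. f x ** g x) \<longlongrightarrow> A ** B) F"
  unfolding matrix_matrix_mult_def by (intro tendsto_intros assms)

lemma tendsto_transpose [tendsto_intros]:
  fixes f :: "'a \<Rightarrow> real^'n^'m"
  assumes "(f \<longlongrightarrow> A) F"
  shows "((\<lambda>x. transpose (f x)) \<longlongrightarrow> transpose A) F"
  unfolding transpose_def by (intro tendsto_intros assms)

lemma tendsto_matrix_vector_mult: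
  fixes f :: "'a \<Rightarrow> real^'n^'m"
  assumes "(f \<longlongrightarrow> A) F"
  shows "((\<lambda>x. f x *v v) \<longlongrightarrow> A *v v) F"
  unfolding matrix_vector_mult_def by (intro tendsto_intros assms)

text \<open>Entries of the limit may vanish, so continuity of \<open>powr p\<close> at 0 is what
  matters; it holds because \<open>0 < p\<close>.\<close>

lemma tendsto_Qp:
  assumes "(f \<longlongrightarrow> L) F" "0 < p"
  shows "((\<lambda>x. Qp p (f x)) \<longlongrightarrow> Qp p L) F"
  unfolding Qp_def using assms(2)
  by (intro tendsto_sum tendsto_powr' tendsto_rabs tendsto_vec_nth assms(1) tendsto_const) auto

section \<open>Bounds for admissible matrices, sublevel sets of \<open>Qp\<close> and Gram
  factors\<close>

lemma matrix_sequence_bounded: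
  fixes X :: "nat \<Rightarrow> real^'n^'m"
  assumes "\<And>n i j. \<bar>X n $ i $ j\<bar> \<le> B"
  shows "bounded (range X)"
proof -
  have "norm (X n) \<le> (\<Sum>i\<in>(UNIV::'m set). \<Sum>j\<in>(UNIV::'n set). B)" for n
  proof -
    have "norm (X n) \<le> (\<Sum>i\<in>UNIV. norm (X n $ i))"
      unfolding norm_vec_def[of "X n"] by (rule L2_set_le_sum) auto
    also have "\<dots> \<le> (\<Sum>i\<in>(UNIV::'m set). \<Sum>j\<in>(UNIV::'n set). B)"
      by (intro sum_mono order_trans[OF norm_le_l1_cart] assms)
    finally show ?thesis .
  qed
  then show ?thesis
    by (auto simp: bounded_iff)
qed

text \<open>Positivity of the quadratic form at the sum and at the difference of the unit vectors
  for \<open>i\<close> and \<open>k\<close> gives 2 + 2 \<open>F $ i $ k\<close> > 0 and 2 - 2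
  \<open>F $ i $ k\<close> > 0. Factor covariances thus stay in a bounded set.\<close>

lemma admissible_entry_le_1:
  fixes L :: "real^'k^'j"
  assumes "admissible L F"
  shows "\<bar>F $ i $ k\<bar> \<le> 1"
proof (cases "i = k")
  case True
  then show ?thesis using assms by (simp add: admissible_def)
next
  case False
  have pd: "x \<noteq> 0 \<Longrightarrow> x \<bullet> (F *v x) > 0" for x
    using assms by (auto simp: admissible_def positive_definite_def)
  have diag: "F $ l $ l = 1" for l using assms by (simp add: admissible_def)
  have "transpose F = F" using assms by (simp add: admissible_def symmetric_matrix_def)
  then have sym: "F $ k $ i = F $ i $ k" by (metis transpose_def vec_lambda_beta)
  have q: "(axis i 1 + s *\<^sub>R axis k 1) \<bullet> (F *v (axis i 1 + s *\<^sub>R axis k 1)) = 1 + s\<^sup>2 + 2 * s * F $ i $ k" for s :: real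
  proof -
    have "F *v (axis i 1 + s *\<^sub>R axis k 1) = column i F + s *\<^sub>R column k F"
      by (simp add: matrix_vector_right_distrib matrix_vector_mult_basis
          matrix_vector_mult_scaleR)
    then show ?thesis
      by (simp add: inner_add_left inner_axis' column_def diag sym power2_eq_square algebra_simps)
  qed
  have nz: "axis i (1::real) + s *\<^sub>R axis k 1 \<noteq> 0" for s :: real
  proof
    assume "axis i (1::real) + s *\<^sub>R axis k 1 = 0"
    then have "(axis i (1::real) + s *\<^sub>R axis k 1) $ i = 0" by simp
    then show False using False by (simp add: axis_def)
  qed
  show ?thesis
    using pd[OF nz, of 1] pd[OF nz, of "-1"] unfolding q by simp
qed

lemma powr_entry_le_Qp: "\<bar>L $ j $ k\<bar> powr p \<le> Qp p L"
proof -
  have "\<bar>L $ j $ k\<bar> powr p \<le> (\<Sum>k\<in>UNIV. \<bar>L $ j $ k\<bar> powr p)"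
    by (rule member_le_sum) auto
  also have "\<dots> \<le> Qp p L"
    unfolding Qp_def by (rule member_le_sum[where f = "\<lambda>j. \<Sum>k\<in>UNIV. \<bar>L $ j $ k\<bar> powr p"])
      (auto intro: sum_nonneg)
  finally show ?thesis .
qed

text \<open>Coercivity of \<open>Qp\<close>: each summand is at most the whole sum, and the power 1
  / p undoes \<open>powr p\<close>.\<close>

lemma entry_le_Qp_bound:
  assumes "Qp p L \<le> B" "0 < p"
  shows "\<bar>L $ j $ k\<bar> \<le> B powr (1 / p)"
proof -
  have "\<bar>L $ j $ k\<bar> = (\<bar>L $ j $ k\<bar> powr p) powr (1 / p)"
    using assms(2) by (simp add: powr_powr)
  also have "\<dots> \<le> B powr (1 / p)"
    using assms order_trans[OF powr_entry_le_Qp assms(1)] by (intro powr_mono2) auto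
  finally show ?thesis .
qed

text \<open>The diagonal of A A' consists of the squared row norms of A.\<close>

lemma gram_bounded_imp_bounded:
  fixes A :: "nat \<Rightarrow> real^'k^'j"
  assumes "bounded (range (\<lambda>n. A n ** transpose (A n)))"
  shows "bounded (range A)"
proof -
  obtain B where B: "\<And>n. norm (A n ** transpose (A n)) \<le> B"
    using assms by (auto simp: bounded_iff)
  have "\<bar>A n $ i $ j\<bar> \<le> sqrt B" for n i j
  proof (rule real_le_rsqrt)
    have "\<bar>A n $ i $ j\<bar>\<^sup>2 \<le> (norm (A n $ i))\<^sup>2"
      by (intro power_mono component_le_norm_cart) auto
    also have "\<dots> = (A n ** transpose (A n)) $ i $ i"
      by (simp add: power2_norm_eq_inner inner_vec_def matrix_matrix_mult_def transpose_def)
    also have "\<dots> \<le> norm ((A n ** transpose (A n)) $ i)"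
      by (rule order_trans[OF abs_ge_self component_le_norm_cart])
    also have "\<dots> \<le> norm (A n ** transpose (A n))" 
      by (rule Finite_Cartesian_Product.norm_nth_le)
    finally show "\<bar>A n $ i $ j\<bar>\<^sup>2 \<le> B" using B[of n] by simp
  qed
  then show ?thesis by (rule matrix_sequence_bounded)
qed

section \<open>Full-rank factorisations and limits of admissible pairs\<close>

text \<open>A product has rank at most that of its left factor, so A has full column rank and acts
  injectively.\<close>

lemma left_inverse_if_product_full_rank:
  fixes A :: "real^'k^'j" and B :: "real^'n^'k"
  assumes "rank (A ** B) = CARD('k)"
  obtains C where "C ** A = mat 1"
proof -
  have "rank A = CARD('k)"
    using rank_mul_le_left[of A B] rank_bound[of A] assms by simp
  then show ?thesis
    using that full_rank_injective matrix_left_invertible_injective by metis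
qed

text \<open>Since L' has a right inverse and F is invertible, both can be cancelled on the right of
  A A' = L F L', which exhibits L as A times the explicit T = A' C' G. Substituting L = A T and
  cancelling A on both sides leaves T F T' = I.\<close>

lemma loading_factorisation:
  fixes A L :: "real^'k^'j" and F :: "real^'k^'k"
  assumes eq: "A ** transpose A = L ** F ** transpose L"
    and rank: "rank (L ** F ** transpose L) = CARD('k)"
  obtains T where "L = A ** T" "T ** F ** transpose T = mat 1"
proof -
  obtain B where B: "B ** A = mat 1"
    using left_inverse_if_product_full_rank[of A "transpose A"] eq rank by metis
  obtain C where C: "C ** L = mat 1"
    using left_inverse_if_product_full_rank[of L "F ** transpose L"] rank
    by (metis matrix_mul_assoc)
  have C': "transpose L ** transpose C = mat 1" and B': "transpose A ** transpose B = mat 1"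
    using C B by (metis matrix_transpose_mul transpose_mat)+
  have "rank F = CARD('k)"
    using rank_mul_le_left[of "L ** F" "transpose L"] rank_mul_le_right[of L F]
      rank_bound[of F] rank by simp
  then obtain G where "G ** F = mat 1"
    using full_rank_injective matrix_left_invertible_injective by metis
  then have G: "F ** G = mat 1" by (simp add: matrix_left_right_inverse)
  have "A ** (transpose A ** transpose C ** G) = L ** F ** (transpose L ** transpose C) ** G"
    using eq by (metis matrix_mul_assoc)
  also have "\<dots> = L"
    by (simp add: C' matrix_mul_assoc[symmetric] G)
  finally have T: "L = A ** (transpose A ** transpose C ** G)" by simp
  define T where "T = transpose A ** transpose C ** G"
  have "B ** (A ** transpose A) ** transpose B = B ** (L ** F ** transpose L) ** transpose B"
    by (simp add: eq)
  then have "(B ** A) ** (transpose A ** transpose B)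
      = (B ** A) ** (T ** F ** transpose T) ** (transpose A ** transpose B)"
    unfolding T[folded T_def] by (simp add: matrix_transpose_mul matrix_mul_assoc)
  then have "T ** F ** transpose T = mat 1" by (simp add: B B')
  then show ?thesis using that T T_def by blast
qed

text \<open>Symmetry and the unit diagonal are closed conditions, but positive definiteness passes
  to the limit only as semidefiniteness; the rank condition rules out degeneracy. Writing the limit
  covariance as A A' makes its quadratic form a squared norm.\<close>

lemma limit_admissible:
  fixes L :: "nat \<Rightarrow> real^'k^'j" and A :: "real^'k^'j"
  assumes adm: "\<And>n. admissible (L n) (F n)"
    and lim: "F \<longlonglongrightarrow> F0"
    and eq: "L0 ** F0 ** transpose L0 = A ** transpose A"
    and rank: "rank (A ** transpose A) = CARD('k)"
  shows "admissible L0 F0"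
proof -
  have "transpose F0 = F0"
  proof (rule LIMSEQ_unique)
    show "(\<lambda>n. transpose (F n)) \<longlonglongrightarrow> transpose F0" by (intro tendsto_intros lim)
    show "(\<lambda>n. transpose (F n)) \<longlonglongrightarrow> F0"
      using adm lim by (simp add: admissible_def symmetric_matrix_def)
  qed
  moreover have "F0 $ k $ k = 1" for k
  proof (rule LIMSEQ_unique)
    show "(\<lambda>n. F n $ k $ k) \<longlonglongrightarrow> F0 $ k $ k" by (intro tendsto_intros lim)
    show "(\<lambda>n. F n $ k $ k) \<longlonglongrightarrow> 1"
      using adm by (simp add: admissible_def)
  qed
  moreover have "x \<bullet> (F0 *v x) > 0" if "x \<noteq> 0" for x
  proof -
    have "x \<bullet> (F0 *v x) \<ge> 0"
    proof (rule tendsto_lowerbound)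
      show "(\<lambda>n. x \<bullet> (F n *v x)) \<longlonglongrightarrow> x \<bullet> (F0 *v x)"
        by (intro tendsto_intros tendsto_matrix_vector_mult lim)
      show "\<forall>\<^sub>F n in sequentially. 0 \<le> x \<bullet> (F n *v x)"
        using adm that by (intro always_eventually)
          (auto simp: admissible_def positive_definite_def less_imp_le)
    qed simp
    \<comment> \<open>With \<open>x = L\<^sub>0' y\<close>, a zero of the form gives \<open>A' y = 0\<close>, hence \<open>L\<^sub>0 F\<^sub>0 x = A A' y = 0\<close>.\<close>
    moreover have "x \<bullet> (F0 *v x) \<noteq> 0"
    proof
      assume zero: "x \<bullet> (F0 *v x) = 0"
      have "rank F0 = CARD('k)"
        using rank_mul_le_left[of "L0 ** F0" "transpose L0"] rank_mul_le_right[of L0 F0]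
          rank_bound[of F0] rank eq by simp
      then have inj: "inj ((*v) F0)" by (simp add: full_rank_injective)
      obtain C where C: "C ** L0 = mat 1"
        using left_inverse_if_product_full_rank[of L0 "F0 ** transpose L0"] rank eq
        by (metis matrix_mul_assoc)
      have C': "transpose L0 ** transpose C = mat 1"
        using C by (metis matrix_transpose_mul transpose_mat)
      define y where "y = transpose C *v x"
      have Ly: "transpose L0 *v y = x"
        by (simp only: y_def matrix_vector_mul_assoc C' matrix_vector_mul_lid)
      have "(transpose A *v y) \<bullet> (transpose A *v y) = y \<bullet> ((A ** transpose A) *v y)"
        by (simp add: dot_lmul_matrix[symmetric] matrix_vector_mul_assoc[symmetric])
      also have "\<dots> = y \<bullet> (L0 *v (F0 *v x))"
        by (simp only: eq[symmetric] matrix_vector_mul_assoc[symmetric] Ly)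
      also have "\<dots> = (transpose L0 *v y) \<bullet> (F0 *v x)"
        by (simp add: dot_lmul_matrix[symmetric])
      also have "\<dots> = 0" by (simp only: Ly zero)
      finally have "transpose A *v y = 0" by simp
      then have "(A ** transpose A) *v y = 0"
        by (simp add: matrix_vector_mul_assoc[symmetric])
      then have "L0 *v (F0 *v x) = 0"
        by (simp only: eq[symmetric] matrix_vector_mul_assoc[symmetric] Ly)
      \<comment> \<open>Cancelling \<open>L0\<close> by its left inverse and then using injectivity
        of \<open>F0\<close> forces x = 0.\<close>
      then have "C *v (L0 *v (F0 *v x)) = 0" by simp
      then have "(C ** L0) *v (F0 *v x) = 0" by (simp only: matrix_vector_mul_assoc[symmetric])
      then have "F0 *v x = F0 *v 0" by (simp add: C)
      then show False using inj that by (metis injD)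
    qed
    ultimately show ?thesis by simp
  qed
  ultimately show ?thesis
    by (simp add: admissible_def symmetric_matrix_def positive_definite_def)
qed

section \<open>Subsequential limits of minimisers\<close>

lemma is_Qp_minimiserD:
  fixes L L' :: "real^'k^'j"
  assumes "is_Qp_minimiser p S L F"
  shows "admissible L F" "L ** F ** transpose L = S"
    and "admissible L' F' \<Longrightarrow> L' ** F' ** transpose L' = S \<Longrightarrow> Qp p L \<le> Qp p L'"
  using assms by (auto simp: is_Qp_minimiser_def is_arg_min_def not_less)

lemma minimisers_subconverge:
  fixes A L :: "nat \<Rightarrow> real^'k^'j" and S :: "real^'j^'j" and Phi :: "real^'k^'k"
  assumes p: "0 < p"
    and lim: "(\<lambda>n. A n ** transpose (A n)) \<longlonglongrightarrow> S"
    and rank: "rank S = CARD('k)"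
    and min: "\<And>n. is_Qp_minimiser p (A n ** transpose (A n)) (L n) (F n)"
    and min0: "is_Qp_minimiser p S Lam Phi"
  obtains r L0 F0 where "strict_mono r" "(L \<circ> r) \<longlonglongrightarrow> L0" "is_Qp_minimiser p S L0 F0"
proof -
  have "bounded (range A)"
    using lim convergent_imp_bounded gram_bounded_imp_bounded by blast
  then obtain A0 r where r: "strict_mono r" and A0: "(A \<circ> r) \<longlonglongrightarrow> A0"
    using bounded_imp_convergent_subsequence by blast
  have lim_r: "(\<lambda>n. A (r n) ** transpose (A (r n))) \<longlonglongrightarrow> S"
    using LIMSEQ_subseq_LIMSEQ[OF lim r] by (simp add: o_def)
  have A0S: "A0 ** transpose A0 = S"
    using tendsto_matrix_mult[OF A0 tendsto_transpose[OF A0]] lim_r LIMSEQ_unique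
    by (auto simp: o_def)
  \<comment> \<open>\<open>T\<close> is built from the limit \<open>A0\<close> alone, so one fixed
    matrix supplies a competitor for every index.\<close>
  obtain T where T: "Lam = A0 ** T" "T ** Phi ** transpose T = mat 1"
    using loading_factorisation[of A0 Lam Phi] is_Qp_minimiserD(2)[OF min0] A0S rank by metis
  have AT: "(\<lambda>n. Qp p (A (r n) ** T)) \<longlonglongrightarrow> Qp p Lam"
    unfolding T(1) using A0 by (intro tendsto_Qp tendsto_intros p) (simp add: o_def)
  have le: "Qp p (L (r n)) \<le> Qp p (A (r n) ** T)" for n
  proof (rule is_Qp_minimiserD(3)[OF min])
    show "admissible (A (r n) ** T) Phi"
      using is_Qp_minimiserD(1)[OF min0] by (simp add: admissible_def)
    have "A (r n) ** T ** Phi ** transpose (A (r n) ** T)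
        = A (r n) ** (T ** Phi ** transpose T) ** transpose (A (r n))"
      by (simp add: matrix_transpose_mul matrix_mul_assoc)
    then show "A (r n) ** T ** Phi ** transpose (A (r n) ** T) = A (r n) ** transpose (A (r n))"
      by (simp add: T)
  qed
  obtain B where "\<And>n. norm (Qp p (A (r n) ** T)) \<le> B"
    using convergent_imp_bounded[OF AT] by (auto simp: bounded_iff)
  then have "Qp p (L (r n)) \<le> B" for n
    using le[of n] by (smt (verit) real_norm_def)
  then have "bounded (range (L \<circ> r))"
    by (intro matrix_sequence_bounded[of _ "B powr (1 / p)"]) (simp add: entry_le_Qp_bound p)
  moreover have "bounded (range (F \<circ> r))"
    using admissible_entry_le_1[OF is_Qp_minimiserD(1)[OF min]]
    by (intro matrix_sequence_bounded[of _ 1]) simp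
  \<comment> \<open>Treating the pair as one sequence yields a common subsequence for loadings and
    covariances.\<close>
  ultimately have "bounded (range (\<lambda>n. (L (r n), F (r n))))"
    by (intro bounded_subset[OF bounded_Times]) auto
  then obtain LF q where q: "strict_mono q" and LF: "(\<lambda>n. (L (r (q n)), F (r (q n)))) \<longlonglongrightarrow> LF"
    using bounded_imp_convergent_subsequence[of "\<lambda>n. (L (r n), F (r n))"] by (auto simp: o_def)
  define L0 F0 where "L0 = fst LF" and "F0 = snd LF"
  have L0: "(\<lambda>n. L (r (q n))) \<longlonglongrightarrow> L0" and F0: "(\<lambda>n. F (r (q n))) \<longlonglongrightarrow> F0"
    using tendsto_fst[OF LF] tendsto_snd[OF LF] by (auto simp: L0_def F0_def)
  have "(\<lambda>n. L (r (q n)) ** F (r (q n)) ** transpose (L (r (q n))))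
      \<longlonglongrightarrow> L0 ** F0 ** transpose L0"
    by (intro tendsto_intros L0 F0)
  moreover have "(\<lambda>n. L (r (q n)) ** F (r (q n)) ** transpose (L (r (q n)))) \<longlonglongrightarrow> S"
    unfolding is_Qp_minimiserD(2)[OF min] using LIMSEQ_subseq_LIMSEQ[OF lim_r q]
    by (simp add: o_def)
  ultimately have S0: "L0 ** F0 ** transpose L0 = S" by (rule LIMSEQ_unique)
  have adm0: "admissible L0 F0"
    using limit_admissible[OF is_Qp_minimiserD(1)[OF min] F0] S0 A0S rank by metis
  \<comment> \<open>The comparison \<open>le\<close> passes to the limit; a feasible point whose
    value does not exceed that of the minimiser \<open>Lam\<close> is itself a minimiser.\<close>
  have "Qp p L0 \<le> Qp p Lam"
    using LIMSEQ_subseq_LIMSEQ[OF AT q] le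
    by (intro LIMSEQ_le[OF tendsto_Qp[OF L0 p]]) (auto simp: o_def)
  then have "is_Qp_minimiser p S L0 F0"
    using is_Qp_minimiserD[OF min0] adm0 S0
    by (fastforce simp: is_Qp_minimiser_def is_arg_min_def)
  moreover have "strict_mono (r \<circ> q)" using r q by (rule strict_mono_o)
  ultimately show ?thesis using that[of "r \<circ> q" L0 F0] L0 by (simp add: o_def)
qed

section \<open>Signed column permutations and thresholded signs\<close>

text \<open>The same \<open>\<pi>\<close> and \<open>s\<close> serve every \<open>X\<close>, so the
  formula applies both to a loading matrix and to its sign matrix.\<close>

lemma signed_permutation_entry:
  fixes L :: "real^'k^'j"
  assumes "D \<in> permutation_matrices" "Dt \<in> sign_flip_matrices"
  obtains \<pi> s where "\<pi> permutes UNIV" "\<And>k. \<bar>s k\<bar> = 1"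
    "\<And>(X :: real^'k^'j) j k. (X ** D ** Dt) $ j $ k = X $ j $ \<pi> k * s k"
proof -
  obtain \<pi> where \<pi>: "\<pi> permutes UNIV" "D = (\<chi> i j. if i = \<pi> j then 1 else 0)"
    using assms(1) by (auto simp: permutation_matrices_def)
  have XD: "(X ** D) $ j $ k = X $ j $ \<pi> k" for X :: "real^'k^'j" and j k
    by (simp add: matrix_matrix_mult_def \<pi>(2) if_distrib cong: if_cong)
  have off: "i \<noteq> k \<Longrightarrow> Dt $ i $ k = 0" for i k
    using assms(2) by (auto simp: sign_flip_matrices_def diagonal_matrix_def)
  have "(X ** D ** Dt) $ j $ k = X $ j $ \<pi> k * Dt $ k $ k" for X :: "real^'k^'j" and j k
  proof -
    have "(X ** D ** Dt) $ j $ k = (\<Sum>i\<in>UNIV. (X ** D) $ j $ i * Dt $ i $ k)"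
      by (simp add: matrix_matrix_mult_def)
    also have "\<dots> = (\<Sum>i\<in>UNIV. if i = k then (X ** D) $ j $ i * Dt $ i $ k else 0)"
      by (intro sum.cong) (auto simp: off)
    also have "\<dots> = X $ j $ \<pi> k * Dt $ k $ k" by (simp add: XD)
    finally show ?thesis .
  qed
  moreover have "\<bar>Dt $ k $ k\<bar> = 1" for k
  proof -
    have "Dt $ k $ k \<in> {-1, 1}" using assms(2) by (simp add: sign_flip_matrices_def)
    then show ?thesis by auto
  qed
  ultimately show ?thesis using that[OF \<pi>(1), of "\<lambda>k. Dt $ k $ k"] by blast
qed

lemma mat_1_permutation: "mat 1 \<in> permutation_matrices"
  unfolding permutation_matrices_def mat_def
  by (auto intro!: exI[of _ id] permutes_id)

lemma mat_1_sign_flip: "mat 1 \<in> sign_flip_matrices"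
  by (simp add: sign_flip_matrices_def diagonal_matrix_def mat_def)

text \<open>Entries with limit zero eventually fall below \<open>c\<close>; the others have a limit
  beyond \<open>c\<close> or \<open>- c\<close>, so they eventually pass the threshold with the
  right sign. Finitely many entries allow a common index.\<close>

lemma eventually_threshold_sgn_eq:
  fixes L :: "nat \<Rightarrow> real^'k^'j"
  assumes lim: "L \<longlonglongrightarrow> L0" and c: "0 < c"
    and gap: "\<And>j k. L0 $ j $ k \<noteq> 0 \<Longrightarrow> c < \<bar>L0 $ j $ k\<bar>"
  shows "\<forall>\<^sub>F n in sequentially. threshold_sgn_matrix c (L n) = sgn_matrix L0"
proof -
  have ent: "(\<lambda>n. L n $ j $ k) \<longlonglongrightarrow> L0 $ j $ k" for j k
    by (intro tendsto_intros lim)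
  have "\<forall>\<^sub>F n in sequentially.
      sgn (L n $ j $ k) * of_bool (\<bar>L n $ j $ k\<bar> > c) = sgn (L0 $ j $ k)" for j k
  proof -
    consider "L0 $ j $ k = 0" | "L0 $ j $ k > c" | "L0 $ j $ k < - c"
      using gap[of j k] by linarith
    then show ?thesis
    proof cases
      case 1
      then have "\<forall>\<^sub>F n in sequentially. \<bar>L n $ j $ k\<bar> < c"
        using order_tendstoD(2)[OF tendsto_rabs[OF ent], of j k c] c by simp
      then show ?thesis by eventually_elim (use 1 in auto)
    next
      case 2
      show ?thesis
        using order_tendstoD(1)[OF ent 2] by eventually_elim (use c 2 in auto)
    next
      case 3
      show ?thesis
        using order_tendstoD(2)[OF ent 3] by eventually_elim (use c 3 in auto)
    qed
  qed
  then have "\<forall>\<^sub>F n in sequentially. \<forall>j k.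
      sgn (L n $ j $ k) * of_bool (\<bar>L n $ j $ k\<bar> > c) = sgn (L0 $ j $ k)"
    by (intro eventually_all_finite)
  then show ?thesis
    by (simp add: threshold_sgn_matrix_def sgn_matrix_def vec_eq_iff)
qed

definition sign_pattern_recovered :: "real \<Rightarrow> real^'k^'j \<Rightarrow> real^'k^'j \<Rightarrow> bool" where
  "sign_pattern_recovered c L Lam \<longleftrightarrow>
     (\<exists>D\<in>permutation_matrices. \<exists>Dt\<in>sign_flip_matrices.
        threshold_sgn_matrix c L ** D ** Dt = sgn_matrix Lam)"

text \<open>The deterministic core: one \<delta> serves all \<open>A\<close> and all minimisers. The
  form \<open>\<le> \<delta>\<close> is the complement of the event \<open>> \<delta>\<close> in
  convergence in probability.\<close>

lemma sign_pattern_recovered_nearby: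
  fixes Lam :: "real^'k^'j" and Phi :: "real^'k^'k" and S :: "real^'j^'j"
  assumes p: "0 < p"
    and rank: "rank S = CARD('k)"
    and min: "is_Qp_minimiser p S Lam Phi"
    and unique: "\<And>L F. is_Qp_minimiser p S L F \<Longrightarrow>
      \<exists>D\<in>permutation_matrices. \<exists>Dt\<in>sign_flip_matrices. L ** D ** Dt = Lam"
    and c: "0 < c" "\<And>j k. Lam $ j $ k \<noteq> 0 \<Longrightarrow> c < \<bar>Lam $ j $ k\<bar>"
  shows "\<exists>\<delta>>0. \<forall>(A :: real^'k^'j) L F. dist (A ** transpose A) S \<le> \<delta> \<longrightarrow>
    is_Qp_minimiser p (A ** transpose A) L F \<longrightarrow> sign_pattern_recovered c L Lam"
proof (rule ccontr)
  assume *: "\<not> ?thesis"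
  \<comment> \<open>Failure for every radius 1 / (n + 1) produces a sequence of
    counterexamples.\<close>
  have "\<exists>(A :: real^'k^'j) L F. dist (A ** transpose A) S \<le> inverse (real (Suc n)) \<and>
      is_Qp_minimiser p (A ** transpose A) L F \<and> \<not> sign_pattern_recovered c L Lam" for n
    using *[unfolded not_ex, THEN spec, of "inverse (real (Suc n))"] by simp
  then obtain A :: "nat \<Rightarrow> real^'k^'j" and L F where
    A: "\<And>n. dist (A n ** transpose (A n)) S \<le> inverse (real (Suc n))"
    and LF: "\<And>n. is_Qp_minimiser p (A n ** transpose (A n)) (L n) (F n)"
    and bad: "\<And>n. \<not> sign_pattern_recovered c (L n) Lam"
    by metis
  have lim: "(\<lambda>n. A n ** transpose (A n)) \<longlonglongrightarrow> S"
    by (rule metric_tendsto_imp_tendsto[OF LIMSEQ_inverse_real_of_nat])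
      (use A in \<open>auto simp: dist_real_def\<close>)
  obtain r :: "nat \<Rightarrow> nat" and L0 F0 where "(L \<circ> r) \<longlonglongrightarrow> L0" and L0: "is_Qp_minimiser p S L0 F0"
    by (rule minimisers_subconverge[OF p lim rank LF min])
  moreover obtain D Dt where D: "D \<in> permutation_matrices" and Dt: "Dt \<in> sign_flip_matrices"
    and L0_Lam: "L0 ** D ** Dt = Lam"
    using unique[OF L0] by blast
  obtain \<pi> s where \<pi>: "\<pi> permutes UNIV" and s: "\<And>k. \<bar>s k\<bar> = 1"
    and entry: "\<And>(X :: real^'k^'j) j k. (X ** D ** Dt) $ j $ k = X $ j $ \<pi> k * s k"
    using signed_permutation_entry[OF D Dt] by metis
  have Lam_entry: "Lam $ j $ k = L0 $ j $ \<pi> k * s k" for j k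
    using entry[of L0] L0_Lam by simp
  \<comment> \<open>The gap at \<open>c\<close> transfers from \<open>Lam\<close> to
    \<open>L0\<close>: \<open>\<pi>\<close> is surjective, so each column of \<open>L0\<close> is,
    up to sign, a column of \<open>Lam\<close>.\<close>
  have "c < \<bar>L0 $ j $ k\<bar>" if "L0 $ j $ k \<noteq> 0" for j k
  proof -
    obtain k' where k': "k = \<pi> k'" using \<pi> by (metis permutes_surj surjD)
    have "s k' \<noteq> 0" using s[of k'] by auto
    then show ?thesis
      using c(2)[of j k'] that s[of k'] unfolding Lam_entry k' by (simp add: abs_mult)
  qed
  ultimately have "\<forall>\<^sub>F n in sequentially. threshold_sgn_matrix c ((L \<circ> r) n) = sgn_matrix L0"
    using c(1) by (intro eventually_threshold_sgn_eq)
  then obtain n where n: "threshold_sgn_matrix c (L (r n)) = sgn_matrix L0"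
    by (auto simp: eventually_sequentially)
  \<comment> \<open>Signs \<plusminus>1 are fixed by \<open>sgn\<close>, so taking signs commutes
    with the signed permutation.\<close>
  have "sgn (s k) = s k" for k using s[of k] by (auto simp: sgn_if abs_if split: if_splits)
  then have "sgn_matrix L0 ** D ** Dt = sgn_matrix Lam"
    by (simp add: vec_eq_iff entry sgn_matrix_def Lam_entry sgn_mult)
  then have "sign_pattern_recovered c (L (r n)) Lam"
    unfolding sign_pattern_recovered_def n using D Dt by blast
  then show False using bad by blast
qed

section \<open>Measurability and the probabilistic conclusion\<close>

text \<open>With a finite discrete target it suffices that single fibres are Borel, and any function
  whatever can then be composed measurably.\<close>

lemma threshold_sgn_matrix_measurable:
  "threshold_sgn_matrix c \<in> borel \<rightarrow>\<^sub>M count_space {X :: real^'k^'j. \<forall>j k. X $ j $ k \<in> {-1, 0, 1}}"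
proof (subst measurable_count_space_eq2)
  let ?X = "{X :: real^'k^'j. \<forall>j k. X $ j $ k \<in> {-1, 0, 1}}"
  have "?X \<subseteq> (\<lambda>f. \<chi> j k. f (j, k)) ` (UNIV \<rightarrow>\<^sub>E {-1, 0, 1})"
  proof
    fix X assume "X \<in> ?X"
    then have "(\<lambda>(j, k). X $ j $ k) \<in> UNIV \<rightarrow>\<^sub>E {-1, 0, 1}" by auto
    then show "X \<in> (\<lambda>f. \<chi> j k. f (j, k)) ` (UNIV \<rightarrow>\<^sub>E {-1, 0, 1})" 
      by (rule rev_image_eqI) simp
  qed
  then show "finite ?X" by (rule finite_subset) (intro finite_imageI finite_PiE; simp)
  have [measurable]: "(\<lambda>L :: real^'k^'j. L $ j $ k) \<in> borel_measurable borel" for j k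
    by (intro borel_measurable_continuous_onI continuous_intros)
  have "threshold_sgn_matrix c -` {X} \<inter> space borel \<in> sets borel" for X :: "real^'k^'j"
  proof -
    have "threshold_sgn_matrix c -` {X} \<inter> space borel =
        {L \<in> space borel. \<forall>j k. sgn (L $ j $ k) * of_bool (\<bar>L $ j $ k\<bar> > c) = X $ j $ k}"
      by (auto simp: threshold_sgn_matrix_def vec_eq_iff)
    also have "\<dots> \<in> sets borel" by measurable
    finally show ?thesis .
  qed
  then show "threshold_sgn_matrix c \<in> space borel \<rightarrow> ?X \<and>
      (\<forall>X\<in>?X. threshold_sgn_matrix c -` {X} \<inter> space borel \<in> sets borel)"
    by (auto simp: threshold_sgn_matrix_def sgn_if)
qed

theorem theorem2:
  fixes M :: "'w measure"
    and p c :: real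
    and Lstar :: "real^'k^'j" and Phistar :: "real^'k^'k" and Omegastar :: "real^'j^'j"
    and Ahat :: "nat \<Rightarrow> 'w \<Rightarrow> real^'k^'j" and Omegahat :: "nat \<Rightarrow> 'w \<Rightarrow> real^'j^'j"
    and Lhat :: "nat \<Rightarrow> 'w \<Rightarrow> real^'k^'j" and Phihat :: "nat \<Rightarrow> 'w \<Rightarrow> real^'k^'k"
  assumes "prob_space M"
    and p: "0 < p" "p \<le> 1"
    and true_params: "admissible Lstar Phistar"
      "diagonal_matrix Omegastar" "\<forall>j. Omegastar $ j $ j \<ge> 0"
    and initial_estimator: "\<And>N. Ahat N \<in> borel_measurable M"
      "\<And>N. Omegahat N \<in> borel_measurable M"
      "\<And>N. AE \<omega> in M. diagonal_matrix (Omegahat N \<omega>)"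
    and C1: "tendsto_in_probability M (\<lambda>N \<omega>. Ahat N \<omega> ** transpose (Ahat N \<omega>))
               (Lstar ** Phistar ** transpose Lstar)"
      "tendsto_in_probability M Omegahat Omegastar"
    and C2: "rank (Lstar ** Phistar ** transpose Lstar) = CARD('k)"
    and C3: "is_Qp_minimiser p (Lstar ** Phistar ** transpose Lstar) Lstar Phistar"
      "\<And>Ld Phid. is_Qp_minimiser p (Lstar ** Phistar ** transpose Lstar) Ld Phid \<Longrightarrow>
         (Ld, Phid) \<noteq> (Lstar, Phistar) \<Longrightarrow>
         \<exists>D\<in>permutation_matrices. \<exists>Dt\<in>sign_flip_matrices.
           Ld ** D ** Dt = Lstar \<and>
           matrix_inv Dt ** matrix_inv D ** Phid
             ** transpose (matrix_inv D) ** transpose (matrix_inv Dt) = Phistar"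
    and C4: "0 < c" "c < Min {\<bar>Lstar $ j $ k\<bar> | j k. Lstar $ j $ k \<noteq> 0}"
    and estimator: "\<And>N. Lhat N \<in> borel_measurable M"
      "\<And>N. AE \<omega> in M.
         is_Qp_minimiser p (Ahat N \<omega> ** transpose (Ahat N \<omega>)) (Lhat N \<omega>) (Phihat N \<omega>)"
  shows "\<exists>(D :: nat \<Rightarrow> 'w \<Rightarrow> real^'k^'k) (Dt :: nat \<Rightarrow> 'w \<Rightarrow> real^'k^'k).
    (\<forall>N. D N \<in> borel_measurable M \<and> Dt N \<in> borel_measurable M) \<and>
    (\<forall>N. \<forall>\<omega>\<in>space M. D N \<omega> \<in> permutation_matrices \<and> Dt N \<omega> \<in> sign_flip_matrices) \<and>
    (\<lambda>N. measure M {\<omega> \<in> space M.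
        threshold_sgn_matrix c (Lhat N \<omega>) ** D N \<omega> ** Dt N \<omega> = sgn_matrix Lstar})
      \<longlonglongrightarrow> 1"
proof -
  interpret prob_space M by fact
  let ?S = "Lstar ** Phistar ** transpose Lstar"
  let ?T = "\<lambda>N \<omega>. threshold_sgn_matrix c (Lhat N \<omega>)"
  let ?P = "permutation_matrices :: (real^'k^'k) set"
  let ?F = "sign_flip_matrices :: (real^'k^'k) set"
  let ?Min = "{\<bar>Lstar $ j $ k\<bar> | j k. Lstar $ j $ k \<noteq> 0}"
  have gap: "c < \<bar>Lstar $ j $ k\<bar>" if "Lstar $ j $ k \<noteq> 0" for j k
  proof -
    have "?Min \<subseteq> (\<lambda>(j, k). \<bar>Lstar $ j $ k\<bar>) ` UNIV" by auto
    then have "finite ?Min" by (rule finite_subset) simp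
    then have "Min ?Min \<le> \<bar>Lstar $ j $ k\<bar>" using that by (intro Min_le) auto
    then show ?thesis using C4(2) by simp
  qed
  \<comment> \<open>\<open>C3\<close> speaks of the other minimisers only; for the true pair the
    identity matrices serve.\<close>
  have unique: "\<exists>D\<in>permutation_matrices. \<exists>Dt\<in>sign_flip_matrices. L ** D ** Dt = Lstar"
    if "is_Qp_minimiser p ?S L F" for L F
  proof (cases "(L, F) = (Lstar, Phistar)")
    case True
    then have "L ** mat 1 ** mat 1 = Lstar" by simp
    then show ?thesis using mat_1_permutation mat_1_sign_flip by blast
  next
    case False
    then show ?thesis using C3(2)[OF that] by blast
  qed
  have "\<exists>\<delta>>0. \<forall>(A :: real^'k^'j) L F. dist (A ** transpose A) ?S \<le> \<delta> \<longrightarrow>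
      is_Qp_minimiser p (A ** transpose A) L F \<longrightarrow> sign_pattern_recovered c L Lstar"
    by (rule sign_pattern_recovered_nearby[OF p(1) C2 C3(1) _ C4(1)]) (erule unique gap)+
  then obtain \<delta> where \<delta>: "0 < \<delta>"
    and near: "\<And>(A :: real^'k^'j) L F. dist (A ** transpose A) ?S \<le> \<delta> \<Longrightarrow>
       is_Qp_minimiser p (A ** transpose A) L F \<Longrightarrow> sign_pattern_recovered c L Lstar"
    by blast
  \<comment> \<open>Identity matrices are the default where no pair recovers the pattern, so the
    choice lies in the two sets for every \<open>X\<close>.\<close>
  have "\<exists>DD. fst DD \<in> ?P \<and> snd DD \<in> ?F \<and>
      ((\<exists>D\<in>?P. \<exists>Dt\<in>?F. X ** D ** Dt = sgn_matrix Lstar) \<longrightarrow>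
        X ** fst DD ** snd DD = sgn_matrix Lstar)" for X
    using mat_1_permutation mat_1_sign_flip by (metis fst_conv snd_conv)
  then obtain pick where pick: "\<And>X. fst (pick X) \<in> ?P" "\<And>X. snd (pick X) \<in> ?F"
    "\<And>X D Dt. D \<in> ?P \<Longrightarrow> Dt \<in> ?F \<Longrightarrow> X ** D ** Dt = sgn_matrix Lstar \<Longrightarrow>
        X ** fst (pick X) ** snd (pick X) = sgn_matrix Lstar"
    by metis
  \<comment> \<open>The matrices are functions of the thresholded sign matrix, which takes finitely many values;
    this makes any choice of them measurable.\<close>
  define D where "D N \<omega> = fst (pick (?T N \<omega>))" for N \<omega>
  define Dt where "Dt N \<omega> = snd (pick (?T N \<omega>))" for N \<omega>
  have T_meas: "?T N \<in> M \<rightarrow>\<^sub>M count_space {X. \<forall>j k. X $ j $ k \<in> {-1, 0, 1}}" for N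
    by (rule measurable_compose[OF estimator(1) threshold_sgn_matrix_measurable])
  have T_comp: "(\<lambda>\<omega>. h (?T N \<omega>)) \<in> M \<rightarrow>\<^sub>M R" if "\<And>X. h X \<in> space R" for h N and R :: "'r measure"
    using that by (intro measurable_compose[OF T_meas]) auto
  have [measurable]: "D N \<in> borel_measurable M" "Dt N \<in> borel_measurable M" for N
    unfolding D_def Dt_def by (intro T_comp; simp)+
  let ?G = "\<lambda>N. {\<omega> \<in> space M. ?T N \<omega> ** D N \<omega> ** Dt N \<omega> = sgn_matrix Lstar}"
  let ?B = "\<lambda>N. {\<omega> \<in> space M. dist (Ahat N \<omega> ** transpose (Ahat N \<omega>)) ?S > \<delta>}"
  have [measurable]: "(\<lambda>\<omega>. Ahat N \<omega> ** transpose (Ahat N \<omega>)) \<in> borel_measurable M" for N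
  proof (rule measurable_compose[OF initial_estimator(1)])
    show "(\<lambda>A :: real^'k^'j. A ** transpose A) \<in> borel_measurable borel"
      by (intro borel_measurable_continuous_onI)
        (auto simp: continuous_on_def intro!: tendsto_intros)
  qed
  have G_sets: "?G N \<in> events" for N
  proof -
    have "Measurable.pred M (\<lambda>\<omega>. ?T N \<omega> ** D N \<omega> ** Dt N \<omega> = sgn_matrix Lstar)"
      unfolding D_def Dt_def by (rule T_comp) simp
    then show ?thesis by (simp add: pred_def)
  qed
  have B_sets: "?B N \<in> events" for N by measurable
  \<comment> \<open>Outside \<open>?B N\<close> the lemma on nearby covariances applies wherever
    \<open>Lhat\<close> is a minimiser, that is, almost surely; hence the comparison of
    probabilities is monotonicity up to null sets.\<close>
  have "1 - prob (?B N) \<le> prob (?G N)" for N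
  proof -
    have "AE \<omega> in M. \<omega> \<in> space M - ?B N \<longrightarrow> \<omega> \<in> ?G N"
      using estimator(2)[of N]
    proof eventually_elim
      case (elim \<omega>)
      show ?case
      proof
        assume "\<omega> \<in> space M - ?B N"
        then have "sign_pattern_recovered c (Lhat N \<omega>) Lstar" "\<omega> \<in> space M"
          using near[OF _ elim] by auto
        moreover from this obtain E Et where "E \<in> ?P" "Et \<in> ?F"
          "?T N \<omega> ** E ** Et = sgn_matrix Lstar"
          unfolding sign_pattern_recovered_def by blast
        ultimately show "\<omega> \<in> ?G N"
          unfolding D_def Dt_def using pick(3) by simp
      qed
    qed
    then have "prob (space M - ?B N) \<le> prob (?G N)"
      using G_sets by (intro finite_measure_mono_AE)
    then show ?thesis using B_sets by (simp add: prob_compl)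
  qed
  moreover have "(\<lambda>N. 1 - prob (?B N)) \<longlonglongrightarrow> 1 - 0"
    using C1(1) \<delta> unfolding tendsto_in_probability_def by (intro tendsto_diff tendsto_const) auto
  ultimately have "(\<lambda>N. prob (?G N)) \<longlonglongrightarrow> 1"
    by (intro tendsto_sandwich[of "\<lambda>N. 1 - prob (?B N)" "\<lambda>N. prob (?G N)" _ "\<lambda>_. 1"]) auto
  then show ?thesis
    using pick by (intro exI[of _ D] exI[of _ Dt]) (auto simp: D_def Dt_def)
qed

end
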